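(* Let $\tilde\delta$ be a random vector in $\mathbb{R}^n$ with mean $\mathbf{0}$ and covariance matrix $\Sigma\in\mathbb{R}^{n\times n}$ with $\Sigma_{ii}=1$ for all $i\in[n]$. Let $E$ be the edge set of an undirected graph on vertex set $[n]$. Given $p\in(0,1)$, let $\gamma_{ij}\ge \sqrt{n/p}\,\|\Sigma^{1/2}e_{ij}\|$ for all $i,j\in[n]$ such that $\{i,j\}\in E$ or $i=j$. Then the set $$\mathcal{U}_{\mathcal S}=\{\delta\in\mathbb{R}^n : |\delta_i|\le\gamma_{ii}\ \forall i\in[n],\ |\delta_i-\delta_j|\le\gamma_{ij}\ \forall \{i,j\}\in E\}$$ satisfies $\mathbb{P}[\tilde\delta\in\mathcal{U}_{\mathcal S}]\ge 1-p$.
   Context: $[n]=\{1,\dots,n\}$; $\|\cdot\|$ is the Euclidean norm; $\Sigma^{1/2}$ is the symmetric positive semidefinite square root of $\Sigma$. With $e_i$ the standard unit vectors of $\mathbb{R}^n$, $e_{ij}=e_i-e_j$ if $i\ne j$ and $e_{ii}=e_i$. Edges of the graph join distinct vertices, and $\gamma_{ij}=\gamma_{ji}$. *)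

theory Defs
  imports "HOL-Probability.Probability"
begin

definition psd_matrix :: "real ^ 'n ^ 'n \<Rightarrow> bool" where
  "psd_matrix A \<longleftrightarrow> transpose A = A \<and> (\<forall>x. 0 \<le> x \<bullet> (A *v x))"

text \<open>Every positive semidefinite matrix has exactly one positive semidefinite square root,
  so the description below is proper for such matrices (and unspecified otherwise).\<close>

definition sqrt_matrix :: "real ^ 'n ^ 'n \<Rightarrow> real ^ 'n ^ 'n" where
  "sqrt_matrix A = (THE B. psd_matrix B \<and> B ** B = A)"

definition covariance_matrix :: "'a measure \<Rightarrow> ('a \<Rightarrow> real ^ 'n) \<Rightarrow> real ^ 'n ^ 'n" where
  "covariance_matrix M X =
     (\<chi> i j. integral\<^sup>L M (\<lambda>\<omega>. (X \<omega> $ i - integral\<^sup>L M X $ i) * (X \<omega> $ j - integral\<^sup>L M X $ j)))"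

definition unit_diff :: "'n \<Rightarrow> 'n \<Rightarrow> real ^ 'n" where
  "unit_diff i j = (if i = j then axis i 1 else axis i 1 - axis j 1)"

definition uncertainty_set ::
    "'n set set \<Rightarrow> ('n \<Rightarrow> 'n \<Rightarrow> real) \<Rightarrow> (real ^ 'n) set" where
  "uncertainty_set E \<gamma> =
     {d. (\<forall>i. \<bar>d $ i\<bar> \<le> \<gamma> i i) \<and> (\<forall>i j. {i, j} \<in> E \<longrightarrow> \<bar>d $ i - d $ j\<bar> \<le> \<gamma> i j)}"

end

theory Submission
  imports Defs
begin

text \<open>
  Applying Chebyshev's inequality to each constraint separately would make the radii depend on
  the number of constraints, which may exceed $n$. The factor $n$ suffices because one event
  serves all linear functionals simultaneously. Heuristically,
  write $X = \Sigma^{1/2} Z$ with $Z$ of covariance at most the identity. Then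
  $E \|Z\|^2 \le n$, so Markov's inequality gives $\|Z\|^2 < n/p$ with probability at least
  $1 - p$, and on that event Cauchy--Schwarz bounds
  $|v \cdot X| = |\Sigma^{1/2} v \cdot Z|$ by $\sqrt{n/p}\,\|\Sigma^{1/2} v\|$ for every
  vector $v$. The constraints of the uncertainty set are the cases $v = e_{ij}$.

  Since $\Sigma$ may be singular, $\|Z\|^2$ is replaced by the sum of
  $(b \cdot X)^2 / \lambda_b$ over an orthonormal eigenbasis of $\Sigma$, restricted to positive
  eigenvalues; in the directions of the kernel $X$ vanishes almost surely, because its variance
  there is the eigenvalue $0$. This is \<open>multivariate_chebyshev\<close>. It rests on the spectral theorem
  \<open>orthonormal_eigenbasis_exists\<close>, which also yields existence and uniqueness of the positive
  semidefinite square root, so that the definite description in \<open>sqrt_matrix\<close> denotes and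
  $\|\Sigma^{1/2} v\|^2 = v \cdot \Sigma v$.
\<close>

section \<open>The spectral theorem for self-adjoint maps\<close>

text \<open>
  First-order optimality: moving from \<open>v\<close> in the direction of the residual \<open>w = f v - l v\<close>
  changes the excess of the quadratic form over \<open>l\<close> times the squared norm by
  \<open>2 t (w \<bullet> w)\<close> up to a term of order \<open>t\<^sup>2\<close>, which would make it positive for small
  \<open>t > 0\<close> unless \<open>w\<close> vanishes. Invariance of \<open>S\<close> keeps the perturbed point admissible.
\<close>

lemma rayleigh_maximizer_is_eigenvector:
  fixes f :: "'a::euclidean_space \<Rightarrow> 'a"
  assumes lin: "linear f" and sym: "\<And>x y. f x \<bullet> y = x \<bullet> f y"
    and S: "subspace S" and inv: "\<And>x. x \<in> S \<Longrightarrow> f x \<in> S"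
    and v: "v \<in> S" "norm v = 1"
    and maxi: "\<And>x. x \<in> S \<Longrightarrow> x \<bullet> f x \<le> (v \<bullet> f v) * (x \<bullet> x)"
  shows "f v = (v \<bullet> f v) *\<^sub>R v"
proof -
  define l where "l = v \<bullet> f v"
  define w where "w = f v - l *\<^sub>R v"
  define a where "a = w \<bullet> w"
  define c where "c = l * a - w \<bullet> f w"
  have vv: "v \<bullet> v = 1"
    using v(2) by (simp add: dot_square_norm)
  have wS: "w \<in> S"
    unfolding w_def by (intro subspace_diff subspace_scale S inv v)
  have c0: "0 \<le> c"
    using maxi[OF wS] by (simp add: c_def a_def l_def)
  have fvw: "f v \<bullet> w = a + l * (v \<bullet> w)"
    by (simp add: a_def w_def inner_diff_left inner_diff_right algebra_simps inner_commute)
  have ineq: "2 * t * a \<le> t\<^sup>2 * c" for t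
  proof -
    let ?y = "v + t *\<^sub>R w"
    have "?y \<in> S"
      by (intro subspace_add subspace_scale S v wS)
    from maxi[OF this] have "?y \<bullet> f ?y \<le> l * (?y \<bullet> ?y)"
      by (simp add: l_def)
    moreover have "f ?y = f v + t *\<^sub>R f w"
      by (simp add: linear_add[OF lin] linear_scale[OF lin])
    moreover have "v \<bullet> f w = f v \<bullet> w"
      by (simp add: sym)
    ultimately have "l + 2 * t * (f v \<bullet> w) + t\<^sup>2 * (w \<bullet> f w)
        \<le> l * (1 + 2 * t * (v \<bullet> w) + t\<^sup>2 * a)"
      by (simp add: inner_add_left inner_add_right vv l_def[symmetric] a_def
          inner_commute[of w v] inner_commute[of w "f v"] power2_eq_square algebra_simps)
    then show ?thesis
      by (simp add: fvw c_def algebra_simps)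
  qed
  have "a = 0"
  proof (rule ccontr)
    assume "a \<noteq> 0"
    then have a0: "0 < a"
      by (simp add: a_def)
    \<comment> \<open>The step must be small enough for the linear term to dominate; adding 1 avoids
      dividing by zero when \<open>c = 0\<close>.\<close>
    define t where "t = a / (c + 1)"
    have t0: "0 < t"
      using a0 c0 by (simp add: t_def)
    have "2 * a \<le> t * c"
      using ineq[of t] t0 by (simp add: power2_eq_square)
    also have "\<dots> \<le> t * (c + 1)"
      using t0 by simp
    also have "\<dots> = a"
      using c0 by (simp add: t_def)
    finally have "a \<le> 0"
      by simp
    then show False
      using a0 by simp
  qed
  then show ?thesis
    by (simp add: a_def w_def l_def)
qed

lemma rayleigh_maximizer_exists:
  fixes f :: "'a::euclidean_space \<Rightarrow> 'a"
  assumes lin: "linear f" and S: "subspace S" and z: "z \<in> S" "z \<noteq> 0"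
  obtains v where "v \<in> S" "norm v = 1"
    "\<And>x. x \<in> S \<Longrightarrow> x \<bullet> f x \<le> (v \<bullet> f v) * (x \<bullet> x)"
proof -
  let ?K = "sphere 0 1 \<inter> S"
  have norm_in: "(1 / norm x) *\<^sub>R x \<in> ?K" if "x \<in> S" "x \<noteq> 0" for x
    using that S by (auto simp: subspace_scale)
  have "compact ?K"
    using closed_subspace[OF S] by (intro compact_Int_closed) auto
  moreover have "?K \<noteq> {}"
    using norm_in[OF z] by blast
  moreover have "continuous_on ?K (\<lambda>x. x \<bullet> f x)"
    by (intro continuous_intros linear_continuous_on linear_conv_bounded_linear[THEN iffD1] lin)
  ultimately obtain v where v: "v \<in> ?K" and le: "\<And>y. y \<in> ?K \<Longrightarrow> y \<bullet> f y \<le> v \<bullet> f v"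
    using continuous_attains_sup[of ?K "\<lambda>x. x \<bullet> f x"] by blast
  show thesis
  proof
    show "v \<in> S" "norm v = 1"
      using v by auto
    fix x assume x: "x \<in> S"
    show "x \<bullet> f x \<le> (v \<bullet> f v) * (x \<bullet> x)"
    proof (cases "x = 0")
      case True
      then show ?thesis by simp
    next
      case False
      have "(x \<bullet> f x) / (norm x)\<^sup>2 \<le> v \<bullet> f v"
        using le[OF norm_in[OF x False]]
        by (simp add: linear_scale[OF lin] power2_eq_square)
      then show ?thesis
        using False by (simp add: divide_le_eq dot_square_norm)
    qed
  qed
qed

text \<open>
  The eigenvalue of a unit eigenvector is its Rayleigh quotient \<open>b \<bullet> f b\<close>; writing it this way
  spares a separate eigenvalue function.
\<close>

definition orthonormal_eigenvectors :: "('a::euclidean_space \<Rightarrow> 'a) \<Rightarrow> 'a set \<Rightarrow> bool" where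
  "orthonormal_eigenvectors f B \<longleftrightarrow>
     pairwise orthogonal B \<and> (\<forall>b\<in>B. norm b = 1 \<and> f b = (b \<bullet> f b) *\<^sub>R b)"

lemma orthonormal_eigenvectors_card:
  fixes B :: "'a::euclidean_space set"
  assumes "orthonormal_eigenvectors f B"
  shows "finite B" "card B \<le> DIM('a)"
proof -
  have "0 \<notin> B"
    using assms by (auto simp: orthonormal_eigenvectors_def)
  then have "independent B"
    using assms pairwise_orthogonal_independent by (auto simp: orthonormal_eigenvectors_def)
  then show "finite B" "card B \<le> DIM('a)"
    using independent_bound by blast+
qed

text \<open>
  By self-adjointness the orthogonal complement of a set of eigenvectors is invariant, so
  maximizing the quadratic form over the unit sphere of the complement gives a new one.
\<close>

lemma orthonormal_eigenvectors_extend: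
  fixes f :: "'a::euclidean_space \<Rightarrow> 'a"
  assumes lin: "linear f" and sym: "\<And>x y. f x \<bullet> y = x \<bullet> f y"
    and B: "orthonormal_eigenvectors f B" and ns: "span B \<noteq> UNIV"
  obtains v where "v \<notin> B" "orthonormal_eigenvectors f (insert v B)"
proof -
  define S where "S = {y. \<forall>x\<in>B. orthogonal x y}"
  have S: "subspace S"
    unfolding S_def by (rule subspace_orthogonal_to_vectors)
  have inv: "f x \<in> S" if "x \<in> S" for x
  proof -
    have "b \<bullet> f x = 0" if b: "b \<in> B" for b
    proof -
      have "b \<bullet> f x = ((b \<bullet> f b) *\<^sub>R b) \<bullet> x"
        using B b sym[of b x] by (simp add: orthonormal_eigenvectors_def)
      also have "\<dots> = 0"
        using \<open>x \<in> S\<close> b by (simp add: S_def orthogonal_def)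
      finally show ?thesis .
    qed
    then show ?thesis
      by (simp add: S_def orthogonal_def)
  qed
  have "span B \<subset> span UNIV"
    using ns by auto
  then obtain z where "z \<noteq> 0" "\<And>y. y \<in> span B \<Longrightarrow> orthogonal z y"
    using orthogonal_to_subspace_exists_gen[of B UNIV] by blast
  then have z: "z \<in> S" "z \<noteq> 0"
    by (auto simp: S_def orthogonal_commute span_base)
  obtain v where v: "v \<in> S" "norm v = 1"
    and maxi: "\<And>x. x \<in> S \<Longrightarrow> x \<bullet> f x \<le> (v \<bullet> f v) * (x \<bullet> x)"
    using rayleigh_maximizer_exists[OF lin S z] by blast
  show thesis
  proof
    show "v \<notin> B"
      using v by (auto simp: S_def orthogonal_self)
    show "orthonormal_eigenvectors f (insert v B)"
      using B v rayleigh_maximizer_is_eigenvector[OF lin sym S inv v maxi]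
      by (auto simp: orthonormal_eigenvectors_def pairwise_insert S_def orthogonal_commute)
  qed
qed

text \<open>
  An orthonormal set of eigenvectors of greatest cardinality cannot be extended, hence spans.
\<close>

theorem orthonormal_eigenbasis_exists:
  fixes f :: "'a::euclidean_space \<Rightarrow> 'a"
  assumes lin: "linear f" and sym: "\<And>x y. f x \<bullet> y = x \<bullet> f y"
  obtains B where "orthonormal_eigenvectors f B" "span B = UNIV"
proof -
  have ne: "orthonormal_eigenvectors f {}"
    by (simp add: orthonormal_eigenvectors_def)
  have "\<exists>B. orthonormal_eigenvectors f B \<and>
      (\<forall>C. orthonormal_eigenvectors f C \<longrightarrow> card C \<le> card B)"
    using ex_has_greatest_nat[of "orthonormal_eigenvectors f" "{}" card "Suc DIM('a)"] ne
      orthonormal_eigenvectors_card(2)[of f] by (simp add: less_Suc_eq_le)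
  then obtain B where B: "orthonormal_eigenvectors f B"
    and maxi: "\<And>C. orthonormal_eigenvectors f C \<Longrightarrow> card C \<le> card B"
    by blast
  have "span B = UNIV"
  proof (rule ccontr)
    assume "span B \<noteq> UNIV"
    then obtain v where "v \<notin> B" "orthonormal_eigenvectors f (insert v B)"
      using orthonormal_eigenvectors_extend[OF lin sym B] by blast
    with maxi[of "insert v B"] show False
      by (simp add: orthonormal_eigenvectors_card(1)[OF B])
  qed
  with B that show thesis
    by blast
qed

lemma orthonormal_eigenbasis_expand:
  assumes "orthonormal_eigenvectors f B" "span B = UNIV"
  shows "(\<Sum>b\<in>B. (b \<bullet> x) *\<^sub>R b) = x"
  using orthonormal_basis_expand[of B x] assms orthonormal_eigenvectors_card(1)[of f B]
  by (simp add: orthonormal_eigenvectors_def inner_commute)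

lemma orthonormal_eigenbasis_inner:
  assumes "orthonormal_eigenvectors f B" "span B = UNIV"
  shows "x \<bullet> y = (\<Sum>b\<in>B. (b \<bullet> x) * (b \<bullet> y))"
proof -
  have "x \<bullet> y = (\<Sum>b\<in>B. (b \<bullet> x) *\<^sub>R b) \<bullet> y"
    by (simp add: orthonormal_eigenbasis_expand[OF assms])
  then show ?thesis
    by (simp add: inner_sum_left)
qed

section \<open>The positive semidefinite square root\<close>

lemma psd_matrix_self_adjoint:
  assumes "psd_matrix A"
  shows "(A *v x) \<bullet> y = x \<bullet> (A *v y)"
  using assms by (metis dot_lmul_matrix psd_matrix_def transpose_matrix_vector)

lemma psd_matrix_nonneg: "psd_matrix A \<Longrightarrow> 0 \<le> x \<bullet> (A *v x)"
  by (simp add: psd_matrix_def)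

lemma psd_matrix_eigenbasis:
  assumes "psd_matrix A"
  obtains B where "orthonormal_eigenvectors ((*v) A) B" "span B = UNIV"
  using orthonormal_eigenbasis_exists[of "(*v) A"] psd_matrix_self_adjoint[OF assms]
  by (metis matrix_vector_mul_linear)

text \<open>
  The root keeps the eigenbasis and replaces each eigenvalue by its square root.
\<close>

lemma psd_matrix_sqrt_exists:
  fixes A :: "real ^ 'n ^ 'n"
  assumes A: "psd_matrix A"
  shows "\<exists>C. psd_matrix C \<and> C ** C = A"
proof -
  obtain B where B: "orthonormal_eigenvectors ((*v) A) B" "span B = UNIV"
    using psd_matrix_eigenbasis[OF A] .
  note fin = orthonormal_eigenvectors_card(1)[OF B(1)]
  define r where "r b = sqrt (b \<bullet> (A *v b))" for b
  define g where "g x = (\<Sum>b\<in>B. (r b * (b \<bullet> x)) *\<^sub>R b)" for x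
  have lin: "linear g"
    by (rule linearI)
      (simp_all add: g_def inner_add_right algebra_simps sum.distrib scaleR_sum_right)
  have gv: "matrix g *v x = g x" for x
    using lin by (simp add: matrix_works)
  have bg: "b \<bullet> g x = r b * (b \<bullet> x)" if b: "b \<in> B" for b x
  proof -
    have "b \<bullet> g x = (\<Sum>c\<in>B. if c = b then r b * (b \<bullet> x) else 0)"
      unfolding g_def inner_sum_right
      by (rule sum.cong)
        (use B(1) b in \<open>auto simp: orthonormal_eigenvectors_def pairwise_def orthogonal_def
            dot_square_norm\<close>)
    then show ?thesis
      using b fin by simp
  qed
  have xg: "x \<bullet> g y = (\<Sum>b\<in>B. r b * (b \<bullet> x) * (b \<bullet> y))" for x y
    using orthonormal_eigenbasis_inner[OF B, of x "g y"] by (simp add: bg mult_ac)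
  have "transpose (matrix g) = matrix g"
  proof -
    have "y \<bullet> (transpose (matrix g) *v x) = y \<bullet> (matrix g *v x)" for x y
    proof -
      have "y \<bullet> (transpose (matrix g) *v x) = x \<bullet> g y"
        by (simp add: inner_commute[of y] dot_lmul_matrix gv)
      also have "\<dots> = y \<bullet> g x"
        by (simp add: xg mult_ac)
      finally show ?thesis
        by (simp add: gv)
    qed
    then have "transpose (matrix g) *v x = matrix g *v x" for x
      using vector_eq_ldot by blast
    then show ?thesis
      by (simp only: matrix_eq) simp
  qed
  moreover have "0 \<le> x \<bullet> (matrix g *v x)" for x
    by (simp add: gv xg r_def mult.assoc psd_matrix_nonneg[OF A] sum_nonneg)
  moreover have "matrix g ** matrix g = A"
  proof -
    have "g (g x) = A *v x" for x
    proof -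
      have "g (g x) = (\<Sum>b\<in>B. (r b * (r b * (b \<bullet> x))) *\<^sub>R b)"
        unfolding g_def[of "g x"] by (rule sum.cong) (simp_all add: bg)
      also have "\<dots> = (\<Sum>b\<in>B. (b \<bullet> (A *v x)) *\<^sub>R b)"
      proof (rule sum.cong[OF refl])
        fix b assume "b \<in> B"
        then have "A *v b = (b \<bullet> (A *v b)) *\<^sub>R b"
          using B(1) by (simp add: orthonormal_eigenvectors_def)
        then have "b \<bullet> (A *v x) = (b \<bullet> (A *v b)) * (b \<bullet> x)"
          by (metis inner_scaleR_left psd_matrix_self_adjoint[OF A])
        moreover have "r b * r b = b \<bullet> (A *v b)"
          by (simp add: r_def psd_matrix_nonneg[OF A])
        ultimately show "(r b * (r b * (b \<bullet> x))) *\<^sub>R b = (b \<bullet> (A *v x)) *\<^sub>R b"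
          by (simp add: mult.assoc[symmetric])
      qed
      also have "\<dots> = A *v x"
        by (rule orthonormal_eigenbasis_expand[OF B])
      finally show ?thesis .
    qed
    then show ?thesis
      by (simp add: matrix_eq matrix_vector_mul_assoc[symmetric] gv)
  qed
  ultimately show ?thesis
    unfolding psd_matrix_def by blast
qed

text \<open>
  The reason for uniqueness of the root: \<open>C\<^sup>2 - l\<close> factors as \<open>(C + \<surd>l) (C - \<surd>l)\<close>. For
  \<open>l > 0\<close>, the vector \<open>w = C b - \<surd>l b\<close> would therefore be an eigenvector with the negative
  eigenvalue \<open>-\<surd>l\<close>, which positive semidefiniteness excludes unless \<open>w = 0\<close>. For \<open>l = 0\<close>
  the factorization only restates the hypothesis, but the squared norm of \<open>C b\<close> is \<open>b \<bullet> C\<^sup>2 b = 0\<close>.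
\<close>

lemma psd_sqrt_eigenvector:
  fixes C :: "real ^ 'n ^ 'n"
  assumes C: "psd_matrix C" and ev: "(C ** C) *v b = l *\<^sub>R b" and l: "0 \<le> l"
  shows "C *v b = sqrt l *\<^sub>R b"
proof -
  have CC: "C *v (C *v b) = l *\<^sub>R b"
    using ev by (simp add: matrix_vector_mul_assoc)
  show ?thesis
  proof (cases "l = 0")
    case True
    have "(C *v b) \<bullet> (C *v b) = b \<bullet> (C *v (C *v b))"
      by (rule psd_matrix_self_adjoint[OF C])
    then show ?thesis
      by (simp add: CC True)
  next
    case False
    define w where "w = C *v b - sqrt l *\<^sub>R b"
    have "C *v w = (sqrt l * sqrt l) *\<^sub>R b - sqrt l *\<^sub>R (C *v b)"
      using l by (simp add: w_def matrix_vector_mult_diff_distrib CC matrix_vector_mult_scaleR)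
    also have "\<dots> = - sqrt l *\<^sub>R w"
      by (simp add: w_def scaleR_diff_right)
    finally have "0 \<le> - sqrt l * (w \<bullet> w)"
      using psd_matrix_nonneg[OF C, of w] by simp
    moreover have "0 < sqrt l"
      using l False by simp
    ultimately have "w \<bullet> w \<le> 0"
      by (simp add: mult_le_0_iff)
    then have "w = 0"
      using inner_ge_zero[of w] inner_eq_zero_iff[of w] by linarith
    then show ?thesis
      by (simp add: w_def)
  qed
qed

lemma psd_matrix_sqrt_unique:
  fixes C D :: "real ^ 'n ^ 'n"
  assumes A: "psd_matrix A" and C: "psd_matrix C" "C ** C = A" and D: "psd_matrix D" "D ** D = A"
  shows "C = D"
proof -
  obtain B where B: "orthonormal_eigenvectors ((*v) A) B" "span B = UNIV"
    using psd_matrix_eigenbasis[OF A] .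
  have "C *v b = D *v b" if "b \<in> B" for b
  proof -
    have ev: "A *v b = (b \<bullet> (A *v b)) *\<^sub>R b"
      using B(1) that by (simp add: orthonormal_eigenvectors_def)
    show ?thesis
      using psd_sqrt_eigenvector[of _ b "b \<bullet> (A *v b)"] C D ev psd_matrix_nonneg[OF A, of b]
      by metis
  qed
  then have "C *v x = D *v x" for x
    using linear_eq_on_span[of "(*v) C" "(*v) D" B] B(2) by auto
  then show ?thesis
    by (simp add: matrix_eq)
qed

lemma sqrt_matrix_works:
  assumes "psd_matrix A"
  shows "psd_matrix (sqrt_matrix A)" "sqrt_matrix A ** sqrt_matrix A = A"
proof -
  have "\<exists>!C. psd_matrix C \<and> C ** C = A"
    using psd_matrix_sqrt_exists[OF assms] psd_matrix_sqrt_unique[OF assms] by blast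
  from theI'[OF this]
  show "psd_matrix (sqrt_matrix A)" "sqrt_matrix A ** sqrt_matrix A = A"
    by (simp_all add: sqrt_matrix_def)
qed

lemma norm_sqrt_matrix:
  assumes "psd_matrix A"
  shows "norm (sqrt_matrix A *v x) = sqrt (x \<bullet> (A *v x))"
  unfolding norm_eq_sqrt_inner
  by (simp add: psd_matrix_self_adjoint[OF sqrt_matrix_works(1)[OF assms]]
      matrix_vector_mul_assoc sqrt_matrix_works(2)[OF assms])

section \<open>Variances of linear functionals\<close>

text \<open>
  Needed because a Bochner integral of a non-integrable function is 0: without integrability the
  entries of the covariance matrix would not combine linearly.
\<close>

lemma integrable_centred_product:
  fixes X :: "'a \<Rightarrow> real ^ 'n"
  assumes "prob_space M" and [measurable]: "X \<in> borel_measurable M"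
    and X: "integrable M X" and X2: "integrable M (\<lambda>\<omega>. (norm (X \<omega>))\<^sup>2)"
  shows "integrable M (\<lambda>\<omega>. (X \<omega> $ i - c) * (X \<omega> $ j - d))"
proof -
  interpret prob_space M by fact
  have comp: "integrable M (\<lambda>\<omega>. X \<omega> $ k)" for k
    using integrable_bounded_linear[OF bounded_linear_vec_nth X] .
  have prod: "integrable M (\<lambda>\<omega>. X \<omega> $ i * X \<omega> $ j)"
  proof (rule Bochner_Integration.integrable_bound[OF X2])
    show "(\<lambda>\<omega>. X \<omega> $ i * X \<omega> $ j) \<in> borel_measurable M"
      using comp[THEN borel_measurable_integrable] by measurable
    show "AE \<omega> in M. norm (X \<omega> $ i * X \<omega> $ j) \<le> norm ((norm (X \<omega>))\<^sup>2)"
      by (auto simp: abs_mult power2_eq_square intro!: mult_mono component_le_norm_cart)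
  qed
  have "(X \<omega> $ i - c) * (X \<omega> $ j - d)
      = X \<omega> $ i * X \<omega> $ j - d * X \<omega> $ i - c * X \<omega> $ j + c * d" for \<omega>
    by (simp add: algebra_simps)
  then show ?thesis
    using comp prod by simp
qed

lemma covariance_matrix_quadratic_form:
  fixes X :: "'a \<Rightarrow> real ^ 'n"
  assumes "prob_space M" "X \<in> borel_measurable M"
    and "integrable M X" "integrable M (\<lambda>\<omega>. (norm (X \<omega>))\<^sup>2)"
  shows "integrable M (\<lambda>\<omega>. (v \<bullet> (X \<omega> - integral\<^sup>L M X))\<^sup>2)"
    and "v \<bullet> (covariance_matrix M X *v v) = (\<integral>\<omega>. (v \<bullet> (X \<omega> - integral\<^sup>L M X))\<^sup>2 \<partial>M)"
proof -
  let ?Y = "\<lambda>\<omega> i. X \<omega> $ i - integral\<^sup>L M X $ i"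
  have square: "(v \<bullet> (X \<omega> - integral\<^sup>L M X))\<^sup>2
      = (\<Sum>i\<in>UNIV. \<Sum>j\<in>UNIV. v $ i * v $ j * (?Y \<omega> i * ?Y \<omega> j))" for \<omega>
    by (simp add: inner_vec_def power2_eq_square sum_product mult_ac)
  note int = integrable_centred_product[OF assms]
  show "integrable M (\<lambda>\<omega>. (v \<bullet> (X \<omega> - integral\<^sup>L M X))\<^sup>2)"
    unfolding square using int by simp
  show "v \<bullet> (covariance_matrix M X *v v) = (\<integral>\<omega>. (v \<bullet> (X \<omega> - integral\<^sup>L M X))\<^sup>2 \<partial>M)"
    unfolding square using int
    by (simp add: covariance_matrix_def inner_vec_def matrix_vector_mult_def sum_distrib_left mult_ac)
qed

lemma psd_covariance_matrix:
  fixes X :: "'a \<Rightarrow> real ^ 'n"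
  assumes "prob_space M" "X \<in> borel_measurable M"
    and "integrable M X" "integrable M (\<lambda>\<omega>. (norm (X \<omega>))\<^sup>2)"
  shows "psd_matrix (covariance_matrix M X)"
  unfolding psd_matrix_def covariance_matrix_quadratic_form(2)[OF assms]
  by (simp add: covariance_matrix_def transpose_def mult.commute)

section \<open>A Chebyshev inequality holding in all directions at once\<close>

text \<open>
  The good event \<open>G\<close> does not depend on the direction \<open>v\<close>. It is provided as a measurable
  subset of the event that all the inequalities hold, since the latter is an uncountable
  intersection. The dimension enters as a bound on the number of positive eigenvalues, each of
  which contributes exactly 1 to the expectation of the quadratic form \<open>Q\<close>.
\<close>

theorem multivariate_chebyshev:
  fixes X :: "'a \<Rightarrow> real ^ 'n"
  assumes "prob_space M" and meas[measurable]: "X \<in> borel_measurable M"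
    and X: "integrable M X" "integrable M (\<lambda>\<omega>. (norm (X \<omega>))\<^sup>2)"
    and p: "0 < p"
  obtains G where "G \<in> sets M" "1 - p \<le> measure M G"
    "\<And>\<omega> v. \<omega> \<in> G \<Longrightarrow> \<bar>v \<bullet> (X \<omega> - integral\<^sup>L M X)\<bar>
       \<le> sqrt (real CARD('n) / p) * norm (sqrt_matrix (covariance_matrix M X) *v v)"
proof -
  interpret prob_space M by fact
  define A where "A = covariance_matrix M X"
  define Y where "Y \<omega> = X \<omega> - integral\<^sup>L M X" for \<omega>
  note mom = covariance_matrix_quadratic_form[OF assms(1) meas X, folded A_def Y_def]
  have A: "psd_matrix A"
    unfolding A_def by (rule psd_covariance_matrix[OF assms(1) meas X])
  have [measurable]: "Y \<in> borel_measurable M"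
    unfolding Y_def by measurable
  obtain B where B: "orthonormal_eigenvectors ((*v) A) B" "span B = UNIV"
    using psd_matrix_eigenbasis[OF A] .
  note fin = orthonormal_eigenvectors_card(1)[OF B(1)]
  define l where "l b = b \<bullet> (A *v b)" for b
  have l0: "0 \<le> l b" for b
    by (simp add: l_def psd_matrix_nonneg[OF A])
  have bA: "b \<bullet> (A *v x) = l b * (b \<bullet> x)" if "b \<in> B" for b x
  proof -
    have "A *v b = l b *\<^sub>R b"
      using B(1) that by (simp add: orthonormal_eigenvectors_def l_def)
    then show ?thesis
      by (metis inner_scaleR_left psd_matrix_self_adjoint[OF A])
  qed
  have quad: "v \<bullet> (A *v v) = (\<Sum>b\<in>B. l b * (b \<bullet> v)\<^sup>2)" for v
    using orthonormal_eigenbasis_inner[OF B, of v "A *v v"]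
    by (simp add: bA power2_eq_square mult_ac)
  \<comment> \<open>Terms with \<open>l b = 0\<close> are 0 by the convention for division, so only positive eigenvalues
    count.\<close>
  define Q where "Q \<omega> = (\<Sum>b\<in>B. (b \<bullet> Y \<omega>)\<^sup>2 / l b)" for \<omega>
  have intQ: "integrable M Q"
    unfolding Q_def using mom(1) by simp
  have Q0: "0 \<le> Q \<omega>" for \<omega>
    by (simp add: Q_def sum_nonneg l0)
  have "integral\<^sup>L M Q = (\<Sum>b\<in>B. l b / l b)"
    unfolding Q_def using mom(1) by (simp add: mom(2)[symmetric] l_def)
  also have "\<dots> \<le> (\<Sum>b\<in>B. 1)"
    by (intro sum_mono) simp
  also have "\<dots> \<le> real CARD('n)"
    using orthonormal_eigenvectors_card(2)[OF B(1)] by simp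
  finally have EQ: "integral\<^sup>L M Q \<le> real CARD('n)" .
  define c where "c = real CARD('n) / p"
  have c: "0 < c"
    using p by (simp add: c_def)
  have degenerate: "AE \<omega> in M. \<forall>b\<in>B. l b = 0 \<longrightarrow> b \<bullet> Y \<omega> = 0"
  proof (rule AE_finite_allI[OF fin])
    fix b assume "b \<in> B"
    show "AE \<omega> in M. l b = 0 \<longrightarrow> b \<bullet> Y \<omega> = 0"
    proof (cases "l b = 0")
      case True
      then have "(\<integral>\<omega>. (b \<bullet> Y \<omega>)\<^sup>2 \<partial>M) = 0"
        by (simp add: mom(2)[symmetric] l_def)
      then show ?thesis
        using integral_nonneg_eq_0_iff_AE[OF mom(1)[of b]] by simp
    qed simp
  qed
  define G where "G = {\<omega> \<in> space M. Q \<omega> < c \<and> (\<forall>b\<in>B. l b = 0 \<longrightarrow> b \<bullet> Y \<omega> = 0)}"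
  have [measurable]: "Q \<in> borel_measurable M"
    using intQ by blast
  have [measurable]: "Measurable.pred M (\<lambda>\<omega>. \<forall>b\<in>B. l b = 0 \<longrightarrow> b \<bullet> Y \<omega> = 0)"
    using fin by measurable
  have "G \<in> sets M"
    unfolding G_def by measurable
  moreover have "1 - p \<le> measure M G"
  proof -
    have "prob {\<omega> \<in> space M. c \<le> Q \<omega>} \<le> integral\<^sup>L M Q / c"
      by (rule integral_Markov_inequality_measure[OF intQ, of "{}"]) (use Q0 c in auto)
    also have "\<dots> \<le> real CARD('n) / c"
      using EQ c by (simp add: divide_right_mono)
    also have "\<dots> = p"
      using p by (simp add: c_def)
    finally have "1 - p \<le> 1 - prob {\<omega> \<in> space M. c \<le> Q \<omega>}"
      by simp
    also have "\<dots> = prob (space M - {\<omega> \<in> space M. c \<le> Q \<omega>})"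
      by (rule prob_compl[symmetric]) measurable
    also have "\<dots> = prob G"
    proof (rule finite_measure_eq_AE)
      show "AE \<omega> in M. \<omega> \<in> space M - {\<omega> \<in> space M. c \<le> Q \<omega>} \<longleftrightarrow> \<omega> \<in> G"
        using degenerate by eventually_elim (auto simp: G_def)
    qed (use \<open>G \<in> sets M\<close> in measurable)
    finally show ?thesis .
  qed
  moreover have "\<bar>v \<bullet> Y \<omega>\<bar> \<le> sqrt c * norm (sqrt_matrix A *v v)" if \<omega>: "\<omega> \<in> G" for \<omega> v
  proof -
    \<comment> \<open>Cancelling \<open>sqrt (l b)\<close> is legitimate for \<open>l b = 0\<close> too, since then \<open>b \<bullet> Y \<omega> = 0\<close> on
      \<open>G\<close>.\<close>
    have "v \<bullet> Y \<omega> = (\<Sum>b\<in>B. (sqrt (l b) * (b \<bullet> v)) * ((b \<bullet> Y \<omega>) / sqrt (l b)))"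
      unfolding orthonormal_eigenbasis_inner[OF B, of v]
      by (rule sum.cong) (use \<omega> in \<open>auto simp: G_def\<close>)
    then have "(v \<bullet> Y \<omega>)\<^sup>2
        \<le> (\<Sum>b\<in>B. (sqrt (l b) * (b \<bullet> v))\<^sup>2) * (\<Sum>b\<in>B. ((b \<bullet> Y \<omega>) / sqrt (l b))\<^sup>2)"
      by (simp only: Cauchy_Schwarz_ineq_sum)
    also have "\<dots> = (v \<bullet> (A *v v)) * Q \<omega>"
      by (simp add: quad Q_def power_mult_distrib power_divide l0)
    also have "\<dots> \<le> (v \<bullet> (A *v v)) * c"
      using \<omega> by (intro mult_left_mono psd_matrix_nonneg[OF A]) (simp add: G_def)
    finally have "sqrt ((v \<bullet> Y \<omega>)\<^sup>2) \<le> sqrt ((v \<bullet> (A *v v)) * c)"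
      by (rule real_sqrt_le_mono)
    then show ?thesis
      by (simp add: norm_sqrt_matrix[OF A] real_sqrt_mult mult.commute)
  qed
  ultimately show thesis
    using that[of G] by (simp add: A_def Y_def c_def)
qed

section \<open>The uncertainty set\<close>

text \<open>
  Because edges are not loops, the case distinction in \<open>unit_diff\<close> separates vertex bounds from
  edge bounds.
\<close>

lemma uncertainty_set_iff_unit_diff:
  assumes "\<And>e. e \<in> E \<Longrightarrow> card e = 2"
  shows "d \<in> uncertainty_set E \<gamma> \<longleftrightarrow>
    (\<forall>i j. {i, j} \<in> E \<or> i = j \<longrightarrow> \<bar>unit_diff i j \<bullet> d\<bar> \<le> \<gamma> i j)"
proof -
  have edge: "i \<noteq> j" if "{i, j} \<in> E" for i j
    using assms[OF that] by auto
  have vertex_value: "unit_diff i i \<bullet> d = d $ i" for i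
    by (simp add: unit_diff_def inner_axis')
  have edge_value: "unit_diff i j \<bullet> d = d $ i - d $ j" if "{i, j} \<in> E" for i j
    using edge[OF that] by (simp add: unit_diff_def inner_axis' inner_diff_left)
  show ?thesis
    unfolding uncertainty_set_def mem_Collect_eq by (metis vertex_value edge_value)
qed

lemma closed_uncertainty_set: "closed (uncertainty_set E \<gamma>)"
proof -
  have eq: "uncertainty_set E \<gamma> =
      (\<Inter>i. {d. \<bar>d $ i\<bar> \<le> \<gamma> i i}) \<inter>
      (\<Inter>(i, j)\<in>{(i, j). {i, j} \<in> E}. {d. \<bar>d $ i - d $ j\<bar> \<le> \<gamma> i j})"
    by (auto simp: uncertainty_set_def)
  show ?thesis
    unfolding eq by (intro closed_Int closed_INT ballI)
      (auto intro!: closed_Collect_le continuous_intros)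
qed

theorem proposition3:
  fixes M :: "'a measure"
    and X :: "'a \<Rightarrow> real ^ 'n"
    and \<Sigma> :: "real ^ 'n ^ 'n"
    and E :: "'n set set"
    and \<gamma> :: "'n \<Rightarrow> 'n \<Rightarrow> real"
    and p :: real
  assumes "prob_space M"
    and "X \<in> borel_measurable M"
    and "integrable M X"
    and "integrable M (\<lambda>\<omega>. (norm (X \<omega>))\<^sup>2)"
    and "integral\<^sup>L M X = 0"
    and "covariance_matrix M X = \<Sigma>"
    and "\<And>i. \<Sigma> $ i $ i = 1"
    and "\<And>e. e \<in> E \<Longrightarrow> card e = 2"
    and "0 < p" and "p < 1"
    and "\<And>i j. {i, j} \<in> E \<Longrightarrow> \<gamma> i j = \<gamma> j i"
    and "\<And>i j. {i, j} \<in> E \<or> i = j \<Longrightarrow>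
           \<gamma> i j \<ge> sqrt (real CARD('n) / p) * norm (sqrt_matrix \<Sigma> *v unit_diff i j)"
  shows "measure M {\<omega> \<in> space M. X \<omega> \<in> uncertainty_set E \<gamma>} \<ge> 1 - p"
proof -
  interpret prob_space M by fact
  have [measurable]: "uncertainty_set E \<gamma> \<in> sets borel"
    by (rule borel_closed[OF closed_uncertainty_set])
  note [measurable] = assms(2)
  obtain G where G: "G \<in> sets M" "1 - p \<le> measure M G"
    and bound: "\<And>\<omega> v. \<omega> \<in> G \<Longrightarrow>
      \<bar>v \<bullet> X \<omega>\<bar> \<le> sqrt (real CARD('n) / p) * norm (sqrt_matrix \<Sigma> *v v)"
    using multivariate_chebyshev[OF assms(1-4) \<open>0 < p\<close>] assms(5,6) by auto
  have "X \<omega> \<in> uncertainty_set E \<gamma>" if "\<omega> \<in> G" for \<omega>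
  proof -
    have "\<bar>unit_diff i j \<bullet> X \<omega>\<bar> \<le> \<gamma> i j" if "{i, j} \<in> E \<or> i = j" for i j
      by (rule order_trans[OF bound[OF \<open>\<omega> \<in> G\<close>] assms(12)[OF that]])
    then show ?thesis
      by (simp add: uncertainty_set_iff_unit_diff assms(8))
  qed
  then have "G \<subseteq> {\<omega> \<in> space M. X \<omega> \<in> uncertainty_set E \<gamma>}"
    using sets.sets_into_space[OF G(1)] by auto
  moreover have "{\<omega> \<in> space M. X \<omega> \<in> uncertainty_set E \<gamma>} \<in> events"
    by measurable
  ultimately show ?thesis
    using finite_measure_mono G(2) by (meson order_trans)
qed

end
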